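(* Suppose that $X,Y$ are two injective metric spaces. If $R \subset X \times Y$ is a set with $\alpha := \operatorname{dis}(R)/2 < \infty$ and the property that $\pi_X(R)$ spans $X$, then there exists an extension $R \subset \bar R \subset X \times Y$ such that $\pi_X(\bar R)$ is an $\alpha$-net in $X$ and $\operatorname{dis}(\bar R) = \operatorname{dis}(R)$.
   Context: The distance of two points $x,x'$ in a metric space is written $|xx'|$. A metric space $Y$ is called injective if for any isometric embedding $i \colon A \to B$ of metric spaces and any $1$-Lipschitz (distance-nonincreasing) map $f \colon A \to Y$ there exists a $1$-Lipschitz map $g \colon B \to Y$ with $g \circ i = f$. For a relation $R \subset X \times Y$ between metric spaces $X,Y$, the distortion of $R$ is the (possibly infinite) number \[ \operatorname{dis}(R) := \sup\bigl\{ \bigl| |xx'| - |yy'| \bigr| : (x,y), (x',y') \in R \bigr\}. \] The map $\pi_X \colon X \times Y \to X$ is the canonical projection. A subset $A$ of a metric space $X$ spans $X$ if, for every pair $(x,x') \in X \times X$, \[ |xx'| = \sup_{a \in A} \bigl( |xa| - |x'a| \bigr). \] For a constant $\alpha \ge 0$, a set $S \subset X$ is called an $\alpha$-net in $X$ if for every $x \in X$ there exists $z \in S$ such that $|xz| \le \alpha$. *)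

theory Defs
  imports "HOL-Analysis.Analysis"
begin

definition isometric_embedding :: "'a metric \<Rightarrow> 'b metric \<Rightarrow> ('a \<Rightarrow> 'b) \<Rightarrow> bool" where
  "isometric_embedding A B i \<longleftrightarrow>
     i \<in> mspace A \<rightarrow> mspace B \<and>
     (\<forall>a\<in>mspace A. \<forall>a'\<in>mspace A. mdist B (i a) (i a') = mdist A a a')"

text \<open>\<open>Lipschitz_continuous_map\<close> leaves the constant existentially quantified; here it is 1.\<close>

definition one_Lipschitz_map :: "'a metric \<Rightarrow> 'b metric \<Rightarrow> ('a \<Rightarrow> 'b) \<Rightarrow> bool" where
  "one_Lipschitz_map A B f \<longleftrightarrow>
     f \<in> mspace A \<rightarrow> mspace B \<and>
     (\<forall>a\<in>mspace A. \<forall>a'\<in>mspace A. mdist B (f a) (f a') \<le> mdist A a a')"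

text \<open>
  A definition cannot quantify over the carrier types of the test spaces \<open>A\<close> and \<open>B\<close>, so these
  are taken inside \<open>'a option\<close>. This is no restriction: by \<open>injective_metric_extension\<close> below,
  the extension property then holds for test spaces over arbitrary types.
\<close>

definition injective_metric :: "'a metric \<Rightarrow> bool" where
  "injective_metric Y \<longleftrightarrow>
     (\<forall>(A :: 'a option metric) (B :: 'a option metric) i f.
        isometric_embedding A B i \<longrightarrow> one_Lipschitz_map A Y f \<longrightarrow>
        (\<exists>g. one_Lipschitz_map B Y g \<and> (\<forall>a\<in>mspace A. g (i a) = f a)))"

text \<open>The supremum is taken in \<open>[0,\<infinity>]\<close>, so the distortion of the empty relation is \<open>0\<close>.\<close>

definition distortion :: "'a metric \<Rightarrow> 'b metric \<Rightarrow> ('a \<times> 'b) set \<Rightarrow> ennreal" where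
  "distortion X Y R =
     (SUP ((x, y), (x', y')) \<in> R \<times> R. ennreal \<bar>mdist X x x' - mdist Y y y'\<bar>)"

text \<open>The supremum is taken in the extended reals, so the empty set spans only the empty space.\<close>

definition spans :: "'a metric \<Rightarrow> 'a set \<Rightarrow> bool" where
  "spans X A \<longleftrightarrow>
     A \<subseteq> mspace X \<and>
     (\<forall>x\<in>mspace X. \<forall>x'\<in>mspace X.
        ereal (mdist X x x') = (SUP a\<in>A. ereal (mdist X x a - mdist X x' a)))"

definition is_net :: "'a metric \<Rightarrow> real \<Rightarrow> 'a set \<Rightarrow> bool" where
  "is_net X \<alpha> S \<longleftrightarrow>
     0 \<le> \<alpha> \<and> S \<subseteq> mspace X \<and> (\<forall>x\<in>mspace X. \<exists>z\<in>S. mdist X x z \<le> \<alpha>)"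


subsection \<open>Independence of injectivity from the carrier type of the test spaces\<close>

lemma injective_metricD:
  fixes Y :: "'a metric" and A B :: "'a option metric"
  assumes "injective_metric Y" "isometric_embedding A B i" "one_Lipschitz_map A Y f"
  obtains g where "one_Lipschitz_map B Y g" "\<And>a. a \<in> mspace A \<Longrightarrow> g (i a) = f a"
proof -
  have "\<exists>g. one_Lipschitz_map B Y g \<and> (\<forall>a\<in>mspace A. g (i a) = f a)"
    using assms(1)[unfolded injective_metric_def, rule_format, OF assms(2,3)] .
  then show thesis using that by (elim exE conjE) (rule that, auto)
qed

lemma injective_metric_nonempty:
  assumes "injective_metric (Y :: 'a metric)"
  shows "mspace Y \<noteq> {}"
proof -
  define B where "B = metric ({None :: 'a option}, \<lambda>x y. 0)"
  define A where "A = metric ({} :: 'a option set, \<lambda>x y. 0)"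
  have A: "mspace A = {}"
    unfolding A_def by (rule Metric_space.mspace_metric) (simp add: Metric_space_def)
  have B: "mspace B = {None}"
    unfolding B_def by (rule Metric_space.mspace_metric) (simp add: Metric_space_def)
  have "isometric_embedding A B id" "one_Lipschitz_map A Y (\<lambda>_. undefined)"
    by (simp_all add: A isometric_embedding_def one_Lipschitz_map_def)
  with assms obtain g where "one_Lipschitz_map B Y g"
    by (rule injective_metricD)
  then show ?thesis
    by (auto simp: B one_Lipschitz_map_def)
qed

lemma injective_metric_one_point:
  fixes Y :: "'a metric" and s :: "'a \<Rightarrow> real"
  assumes inj: "injective_metric Y"
    and low: "\<And>y y'. y \<in> mspace Y \<Longrightarrow> y' \<in> mspace Y \<Longrightarrow> mdist Y y y' \<le> s y + s y'"
    and lip: "\<And>y y'. y \<in> mspace Y \<Longrightarrow> y' \<in> mspace Y \<Longrightarrow> s y \<le> s y' + mdist Y y y'"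
  shows "\<exists>z\<in>mspace Y. \<forall>y\<in>mspace Y. mdist Y z y \<le> s y"
proof -
  let ?M = "mspace Y"
  have nonneg: "0 \<le> s y" if "y \<in> ?M" for y
    using low[OF that that] mdist_nonneg[of Y y y] by linarith
  show ?thesis
  proof (cases "\<exists>z\<in>?M. s z = 0")
    case True
    then show ?thesis using low by force
  next
    case False
    then have pos: "0 < s y" if "y \<in> ?M" for y
      using nonneg[OF that] that by (metis less_eq_real_def)
    define d where "d u v = (case u of
        None \<Rightarrow> (case v of None \<Rightarrow> 0 | Some y' \<Rightarrow> \<bar>s y'\<bar>)
      | Some y \<Rightarrow> (case v of None \<Rightarrow> \<bar>s y\<bar> | Some y' \<Rightarrow> mdist Y y y'))" for u v
    let ?C = "insert None (Some ` ?M)"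
    have Some_abs: "\<bar>s y\<bar> = s y" if "y \<in> ?M" for y
      using nonneg[OF that] by simp
    interpret C: Metric_space ?C d
    proof
      fix x y show "0 \<le> d x y" by (auto simp: d_def split: option.split)
    next
      fix x y show "d x y = d y x" by (auto simp: d_def mdist_commute split: option.split)
    next
      fix x y assume "x \<in> ?C" "y \<in> ?C"
      then show "d x y = 0 \<longleftrightarrow> x = y"
        using pos by (force simp: d_def)
    next
      fix x y z assume "x \<in> ?C" "y \<in> ?C" "z \<in> ?C"
      then show "d x z \<le> d x y + d y z"
        using nonneg lip low
        by (auto simp: d_def Some_abs mdist_triangle mdist_commute)
           (metis add.commute mdist_commute)+
    qed
    define B where "B = metric (?C, d)"
    define A where "A = metric (Some ` ?M, d)"
    interpret A: Metric_space "Some ` ?M" d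
      by (rule C.subspace) auto
    have "isometric_embedding A B id" "one_Lipschitz_map A Y the"
      by (auto simp: A_def B_def isometric_embedding_def one_Lipschitz_map_def d_def)
    with inj obtain g where g:
      "one_Lipschitz_map B Y g" "\<And>a. a \<in> mspace A \<Longrightarrow> g (id a) = the a"
      by (rule injective_metricD) (rule that)
    have "g (Some y) = y" if "y \<in> ?M" for y
      using g(2)[of "Some y"] that by (simp add: A_def)
    moreover have "mdist Y (g None) (g (Some y)) \<le> s y" if "y \<in> ?M" for y
    proof -
      have "mdist Y (g None) (g (Some y)) \<le> d None (Some y)"
        using g(1) that by (auto simp: one_Lipschitz_map_def B_def)
      then show ?thesis using that by (simp add: d_def Some_abs)
    qed
    moreover have "g None \<in> ?M"
      using g(1) by (auto simp: one_Lipschitz_map_def B_def)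
    ultimately show ?thesis by metis
  qed
qed

lemma injective_metric_balls:
  fixes Y :: "'a metric" and K :: "('a \<times> real) set"
  assumes inj: "injective_metric Y" and sub: "K \<subseteq> mspace Y \<times> UNIV"
    and K: "\<And>y t y' t'. (y, t) \<in> K \<Longrightarrow> (y', t') \<in> K \<Longrightarrow> mdist Y y y' \<le> t + t'"
  shows "\<exists>z\<in>mspace Y. \<forall>(y, t)\<in>K. mdist Y z y \<le> t"
proof (cases "K = {}")
  case True
  then show ?thesis using injective_metric_nonempty[OF inj] by auto
next
  case False
  let ?M = "mspace Y"
  define s where "s y = (INF (u, t)\<in>K. t + mdist Y y u)" for y
  have K_nonneg: "0 \<le> t" if "(u, t) \<in> K" for u t
    using K[OF that that] mdist_nonneg[of Y u u] by linarith
  have bdd: "bdd_below ((\<lambda>(u, t). t + mdist Y y u) ` K)" for y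
    by (rule bdd_belowI[of _ 0]) (auto simp: K_nonneg)
  have s_le: "s y \<le> t + mdist Y y u" if "(u, t) \<in> K" for y u t
    unfolding s_def using cINF_lower[OF bdd that] by simp
  have s_ge: "c \<le> s y" if "\<And>u t. (u, t) \<in> K \<Longrightarrow> c \<le> t + mdist Y y u" for c y
    unfolding s_def using that by (intro cINF_greatest[OF False]) auto
  have "mdist Y y y' \<le> s y + s y'" if y: "y \<in> ?M" and y': "y' \<in> ?M" for y y'
  proof -
    have *: "mdist Y y y' \<le> (t + mdist Y y u) + (t' + mdist Y y' u')"
      if u: "(u, t) \<in> K" and u': "(u', t') \<in> K" for u t u' t'
    proof -
      have "u \<in> ?M" "u' \<in> ?M" using sub u u' by auto
      then have "mdist Y y y' \<le> mdist Y y u + mdist Y u y'"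
        and "mdist Y u y' \<le> mdist Y u u' + mdist Y u' y'"
        using y y' by (auto intro: mdist_triangle)
      then show ?thesis using K[OF u u'] mdist_commute[of Y y' u'] by linarith
    qed
    have "mdist Y y y' - s y' \<le> s y"
    proof (rule s_ge)
      fix u t assume u: "(u, t) \<in> K"
      have "mdist Y y y' - (t + mdist Y y u) \<le> s y'"
        by (rule s_ge) (use *[OF u] in force)
      then show "mdist Y y y' - s y' \<le> t + mdist Y y u" by linarith
    qed
    then show ?thesis by linarith
  qed
  moreover have "s y \<le> s y' + mdist Y y y'" if y: "y \<in> ?M" and y': "y' \<in> ?M" for y y'
  proof -
    have "s y - mdist Y y y' \<le> s y'"
    proof (rule s_ge)
      fix u t assume u: "(u, t) \<in> K"
      then have "u \<in> ?M" using sub by auto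
      then have "mdist Y y u \<le> mdist Y y y' + mdist Y y' u"
        using y y' by (auto intro: mdist_triangle)
      then show "s y - mdist Y y y' \<le> t + mdist Y y' u"
        using s_le[OF u, of y] by linarith
    qed
    then show ?thesis by linarith
  qed
  ultimately obtain z where z: "z \<in> ?M" "\<And>y. y \<in> ?M \<Longrightarrow> mdist Y z y \<le> s y"
    using injective_metric_one_point[OF inj, of s] by blast
  have "mdist Y z y \<le> t" if "(y, t) \<in> K" for y t
  proof -
    have "y \<in> ?M" using sub that by auto
    then have "mdist Y y y = 0" by simp
    with z(2)[OF \<open>y \<in> ?M\<close>] s_le[OF that, of y] show ?thesis by linarith
  qed
  then show ?thesis using z(1) by auto
qed

theorem injective_metric_extension:
  fixes Y :: "'a metric" and A :: "'s metric" and B :: "'t metric"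
  assumes inj: "injective_metric Y"
    and i: "isometric_embedding A B i" and f: "one_Lipschitz_map A Y f"
  shows "\<exists>g. one_Lipschitz_map B Y g \<and> (\<forall>a\<in>mspace A. g (i a) = f a)"
proof -
  define good where "good G \<longleftrightarrow> G \<subseteq> mspace B \<times> mspace Y \<and>
    (\<forall>(b, y)\<in>G. \<forall>(b', y')\<in>G. mdist Y y y' \<le> mdist B b b')" for G
  define G0 where "G0 = (\<lambda>a. (i a, f a)) ` mspace A"
  have "good G0"
    using i f unfolding good_def G0_def isometric_embedding_def one_Lipschitz_map_def
    by (simp add: Pi_iff image_subset_iff)
  have "\<exists>G\<in>{G. good G \<and> G0 \<subseteq> G}. \<forall>H\<in>{G. good G \<and> G0 \<subseteq> G}. G \<subseteq> H \<longrightarrow> H = G"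
  proof (rule subset_Zorn_nonempty)
    show "{G. good G \<and> G0 \<subseteq> G} \<noteq> {}" using \<open>good G0\<close> by auto
  next
    fix \<C> assume ne: "\<C> \<noteq> {}" and ch: "subset.chain {G. good G \<and> G0 \<subseteq> G} \<C>"
    have mem: "\<And>G. G \<in> \<C> \<Longrightarrow> good G \<and> G0 \<subseteq> G"
      and lin: "\<And>G H. G \<in> \<C> \<Longrightarrow> H \<in> \<C> \<Longrightarrow> G \<subseteq> H \<or> H \<subseteq> G"
      using ch by (auto simp: subset_chain_def)
    have "mdist Y y y' \<le> mdist B b b'"
      if bG: "(b, y) \<in> G" "G \<in> \<C>" "(b', y') \<in> H" "H \<in> \<C>" for b y b' y' G H
    proof -
      obtain L where "L \<in> \<C>" "(b, y) \<in> L" "(b', y') \<in> L"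
        using lin[OF bG(2,4)] bG by blast
      then show ?thesis using mem[of L] by (auto simp: good_def)
    qed
    moreover have "\<Union>\<C> \<subseteq> mspace B \<times> mspace Y"
      using mem unfolding good_def by blast
    ultimately have "good (\<Union>\<C>)"
      unfolding good_def by blast
    then show "\<Union>\<C> \<in> {G. good G \<and> G0 \<subseteq> G}" using mem ne by blast
  qed
  then obtain G where G: "good G" "G0 \<subseteq> G"
    and max: "\<And>H. good H \<Longrightarrow> G \<subseteq> H \<Longrightarrow> H = G"
    by (metis (mono_tags, lifting) mem_Collect_eq order_trans)
  have Gsub: "b \<in> mspace B" "y \<in> mspace Y" if "(b, y) \<in> G" for b y
    using G(1) that by (auto simp: good_def)
  have Gd: "mdist Y y y' \<le> mdist B b b'" if "(b, y) \<in> G" "(b', y') \<in> G" for b y b' y'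
    using G(1) that by (auto simp: good_def)
  have total: "\<exists>y. (b, y) \<in> G" if b: "b \<in> mspace B" for b
  proof -
    define K where "K = (\<lambda>(b', y). (y, mdist B b b')) ` G"
    have "K \<subseteq> mspace Y \<times> UNIV" by (auto simp: K_def Gsub)
    moreover have "mdist Y y y' \<le> t + t'" if yt: "(y, t) \<in> K" "(y', t') \<in> K" for y t y' t'
    proof -
      obtain c c' where c: "(c, y) \<in> G" "t = mdist B b c" "(c', y') \<in> G" "t' = mdist B b c'"
        using yt by (auto simp: K_def)
      have "mdist B c c' \<le> mdist B c b + mdist B b c'"
        using b c Gsub by (auto intro: mdist_triangle)
      then show ?thesis using Gd[OF c(1,3)] c mdist_commute[of B b c] by linarith
    qed
    ultimately obtain z where z: "z \<in> mspace Y" "\<forall>(y, t)\<in>K. mdist Y z y \<le> t"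
      using injective_metric_balls[OF inj, of K] by blast
    then have zG: "mdist Y z y \<le> mdist B b c" if "(c, y) \<in> G" for c y
      using that by (force simp: K_def)
    then have zG': "mdist Y y z \<le> mdist B c b" if "(c, y) \<in> G" for c y
      using that by (metis mdist_commute)
    have "mdist Y z z \<le> mdist B b b"
      using b z(1) by (metis mdist_zero order_refl)
    then have "good (insert (b, z) G)"
      using G(1) b z(1) zG zG' by (auto simp: good_def)
    then have "insert (b, z) G = G" by (intro max) auto
    then show ?thesis by auto
  qed
  define g where "g b = (SOME y. (b, y) \<in> G)" for b
  have g: "(b, g b) \<in> G" if "b \<in> mspace B" for b
    unfolding g_def using total[OF that] by (rule someI_ex)
  have "one_Lipschitz_map B Y g"
    unfolding one_Lipschitz_map_def by (intro conjI funcsetI ballI Gsub(2)[OF g] Gd g)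
  moreover have "g (i a) = f a" if a: "a \<in> mspace A" for a
  proof -
    have ia: "(i a, f a) \<in> G" using G(2) a by (auto simp: G0_def)
    have gia: "(i a, g (i a)) \<in> G" by (rule g[OF Gsub(1)[OF ia]])
    have "mdist B (i a) (i a) = 0" using Gsub(1)[OF ia] by simp
    then have "mdist Y (g (i a)) (f a) = 0"
      using Gd[OF gia ia] mdist_nonneg[of Y "g (i a)" "f a"] by linarith
    then show ?thesis
      using mdist_zero[OF Gsub(2)[OF gia] Gsub(2)[OF ia]] by blast
  qed
  ultimately show ?thesis by blast
qed

end

theory Submission
  imports Defs
begin

text \<open>
  Let \<open>R'\<close> be a maximal extension of \<open>R\<close> all of whose pairs of points have their distances in
  \<open>X\<close> and \<open>Y\<close> within \<open>2\<alpha>\<close> of each other. The first projection of \<open>R'\<close> is an \<open>\<alpha>\<close>-net as soon as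
  for each \<open>x\<close> in \<open>X\<close> some pair \<open>(z, y)\<close> with \<open>|xz| \<le> \<alpha>\<close> can be added to \<open>R'\<close> without
  violating this bound, for then \<open>(z, y)\<close> lies in \<open>R'\<close> already.

  Such a pair is found halfway between \<open>X\<close> and \<open>Y\<close> (lemma \<open>compatible_pair_near\<close>).
  The average \<open>D\<close> of the two distances on \<open>R'\<close> differs from either of them by at most \<open>\<alpha>\<close>.
  The function \<open>g r = |x x\<^sub>r| + \<alpha>/2\<close> satisfies \<open>D r s \<le> g r + g s\<close> for all \<open>r\<close> and \<open>s\<close> in \<open>R'\<close>;
  shrink it to a minimal \<open>g\<close> with this property, a point of the tight span of \<open>(R', D)\<close>. The balls of radius
  \<open>g r + \<alpha>/2\<close> around the points \<open>x\<^sub>r\<close> meet pairwise in \<open>X\<close>, and so do those around the points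
  \<open>y\<^sub>r\<close> in \<open>Y\<close>; by injectivity there are common points \<open>z\<close> and \<open>y\<close>. Minimality of \<open>g\<close>
  turns these upper bounds into lower ones, so that \<open>|z x\<^sub>r|\<close> and \<open>|y y\<^sub>r|\<close> both lie in the interval
  \<open>[g r - 3\<alpha>/2, g r + \<alpha>/2]\<close>, whose length is \<open>2\<alpha>\<close>. Since \<open>|z x\<^sub>r| \<le> |x x\<^sub>r| + \<alpha>\<close> for all \<open>r\<close> and
  the points \<open>x\<^sub>r\<close> span \<open>X\<close>, it follows that \<open>|xz| \<le> \<alpha>\<close>.
\<close>

text \<open>
  Zorn's lemma in the form in which both the relation \<open>R'\<close> and the minimal function \<open>g\<close> are found:
  a condition on pairs of elements passes to unions of chains.
\<close>

lemma maximal_clique_exists: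
  assumes sym: "symp P" and C: "C \<subseteq> U" "\<forall>p\<in>C. \<forall>q\<in>C. P p q"
  shows "\<exists>M. C \<subseteq> M \<and> M \<subseteq> U \<and> (\<forall>p\<in>M. \<forall>q\<in>M. P p q) \<and>
    (\<forall>p\<in>U. P p p \<longrightarrow> (\<forall>q\<in>M. P p q) \<longrightarrow> p \<in> M)"
proof -
  let ?\<A> = "{M. C \<subseteq> M \<and> M \<subseteq> U \<and> (\<forall>p\<in>M. \<forall>q\<in>M. P p q)}"
  have "\<exists>M\<in>?\<A>. \<forall>N\<in>?\<A>. M \<subseteq> N \<longrightarrow> N = M"
  proof (rule subset_Zorn_nonempty)
    show "?\<A> \<noteq> {}" using C by auto
  next
    fix \<C> assume ne: "\<C> \<noteq> {}" and ch: "subset.chain ?\<A> \<C>"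
    have mem: "\<And>G. G \<in> \<C> \<Longrightarrow> C \<subseteq> G \<and> G \<subseteq> U \<and> (\<forall>p\<in>G. \<forall>q\<in>G. P p q)"
      and lin: "\<And>G H. G \<in> \<C> \<Longrightarrow> H \<in> \<C> \<Longrightarrow> G \<subseteq> H \<or> H \<subseteq> G"
      using ch by (auto simp: subset_chain_def)
    have "P p q" if "p \<in> G" "G \<in> \<C>" "q \<in> H" "H \<in> \<C>" for p q G H
      using lin[OF that(2,4)] mem[OF that(2)] mem[OF that(4)] that by blast
    then show "\<Union>\<C> \<in> ?\<A>" using mem ne by blast
  qed
  then obtain M where "M \<in> ?\<A>" and max: "\<forall>N\<in>?\<A>. M \<subseteq> N \<longrightarrow> N = M"
    by (elim bexE)
  then have M: "C \<subseteq> M" "M \<subseteq> U" "\<And>p q. p \<in> M \<Longrightarrow> q \<in> M \<Longrightarrow> P p q"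
    by auto
  have "p \<in> M" if p: "p \<in> U" "P p p" "\<forall>q\<in>M. P p q" for p
  proof -
    have "insert p M = M"
      by (rule max[rule_format]) (use M p sympD[OF sym] in auto)
    then show ?thesis by blast
  qed
  with M show ?thesis by (intro exI[of _ M] conjI ballI impI)
qed

text \<open>
  The inequality \<open>|za| \<le> |xa| + c\<close> is one-sided, yet it bounds \<open>|zx|\<close>: spanning determines \<open>|zx|\<close>
  by the differences \<open>|za| - |xa|\<close> without absolute values.
\<close>

lemma spans_mdist_le:
  assumes "spans X A" "x \<in> mspace X" "z \<in> mspace X"
    and "\<And>a. a \<in> A \<Longrightarrow> mdist X z a \<le> mdist X x a + c"
  shows "mdist X z x \<le> c"
proof -
  have "ereal (mdist X z x) = (SUP a\<in>A. ereal (mdist X z a - mdist X x a))"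
    using assms(1-3) by (auto simp: spans_def)
  also have "\<dots> \<le> ereal c"
    using assms(4) by (intro SUP_least) (simp add: algebra_simps)
  finally show ?thesis by simp
qed

lemma distortion_le_iff:
  assumes "0 \<le> c"
  shows "distortion X Y R \<le> ennreal c \<longleftrightarrow>
    (\<forall>(x, y)\<in>R. \<forall>(x', y')\<in>R. \<bar>mdist X x x' - mdist Y y y'\<bar> \<le> c)"
  using assms by (fastforce simp: distortion_def SUP_le_iff)

text \<open>
  The upper estimate is the intersection of the balls of radius \<open>t + \<alpha>/2\<close>, which meet pairwise because
  \<open>D\<close> is at most \<open>\<alpha>\<close> smaller than the metric. For the lower one, let \<open>g\<close> be the function
  whose graph bounds \<open>E\<close> from below; the claim is \<open>g r \<le> |z p\<^sub>r| + 3\<alpha>/2\<close>. Maximality of \<open>E\<close>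
  stands for minimality of \<open>g\<close> and requires only \<open>D r s \<le> |z p\<^sub>r| + 3\<alpha>/2 + u\<close> for
  \<open>(s, u) \<in> E\<close>, which is the triangle inequality through \<open>z\<close>.
\<close>

lemma injective_metric_realizes_minimal_radii:
  fixes X :: "'a metric" and E :: "('i \<times> real) set"
  assumes inj: "injective_metric X" and "0 \<le> \<alpha>"
    and p: "\<And>r. r \<in> R \<Longrightarrow> p r \<in> mspace X"
    and D: "\<And>r s. r \<in> R \<Longrightarrow> s \<in> R \<Longrightarrow> \<bar>D r s - mdist X (p r) (p s)\<bar> \<le> \<alpha>"
    and ER: "\<And>r t. (r, t) \<in> E \<Longrightarrow> r \<in> R"
    and E_le: "\<And>r t s u. (r, t) \<in> E \<Longrightarrow> (s, u) \<in> E \<Longrightarrow> D r s \<le> t + u"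
    and E_max: "\<And>r c. r \<in> R \<Longrightarrow> 0 \<le> c \<Longrightarrow> (\<And>s u. (s, u) \<in> E \<Longrightarrow> D r s \<le> c + u) \<Longrightarrow> (r, c) \<in> E"
  shows "\<exists>z\<in>mspace X. (\<forall>(r, t)\<in>E. mdist X z (p r) \<le> t + \<alpha> / 2) \<and>
    (\<forall>r\<in>R. (r, mdist X z (p r) + 3 * \<alpha> / 2) \<in> E)"
proof -
  let ?K = "(\<lambda>(r, t). (p r, t + \<alpha> / 2)) ` E"
  have "\<exists>z\<in>mspace X. \<forall>(a, t)\<in>?K. mdist X z a \<le> t"
  proof (rule injective_metric_balls[OF inj])
    show "?K \<subseteq> mspace X \<times> UNIV"
      using ER p by auto
    show "mdist X a a' \<le> t + t'" if K: "(a, t) \<in> ?K" "(a', t') \<in> ?K" for a t a' t'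
    proof -
      obtain r v s u where rv: "(r, v) \<in> E" "a = p r" "t = v + \<alpha> / 2"
        and su: "(s, u) \<in> E" "a' = p s" "t' = u + \<alpha> / 2"
        using K by auto
      show ?thesis
        using D[OF ER[OF rv(1)] ER[OF su(1)]] E_le[OF rv(1) su(1)] rv su
        by (simp add: abs_le_iff)
    qed
  qed
  then obtain z where z: "z \<in> mspace X" and zK: "\<forall>(a, t)\<in>?K. mdist X z a \<le> t"
    by (elim bexE)
  have zE: "mdist X z (p r) \<le> t + \<alpha> / 2" if "(r, t) \<in> E" for r t
    using zK that by force
  have "(r, mdist X z (p r) + 3 * \<alpha> / 2) \<in> E" if r: "r \<in> R" for r
  proof (rule E_max[OF r])
    show "0 \<le> mdist X z (p r) + 3 * \<alpha> / 2" using \<open>0 \<le> \<alpha>\<close> by simp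
  next
    fix s u assume su: "(s, u) \<in> E"
    have "mdist X (p r) (p s) \<le> mdist X (p r) z + mdist X z (p s)"
      by (intro mdist_triangle p[OF r] p[OF ER[OF su]] z)
    then show "D r s \<le> mdist X z (p r) + 3 * \<alpha> / 2 + u"
      using D[OF r ER[OF su]] zE[OF su] by (simp add: mdist_commute[of X "p r" z] abs_le_iff)
  qed
  then show ?thesis using z zE by (intro bexI[of _ z]) auto
qed

text \<open>
  Taking the average \<open>D\<close> as the common approximation splits the discrepancy \<open>2\<alpha>\<close> of the two
  metrics evenly. Choosing \<open>y\<close> by minimal radii for the metric of \<open>Y\<close> alone,
  and \<open>z\<close> by the same radii enlarged by \<open>\<alpha>\<close>, would by the same argument only give \<open>|yb| \<le> |za| + 3\<alpha>\<close>.
\<close>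

lemma compatible_pair_near:
  fixes X :: "'a metric" and Y :: "'b metric" and R :: "('a \<times> 'b) set"
  assumes inj: "injective_metric X" "injective_metric Y"
    and R: "R \<subseteq> mspace X \<times> mspace Y" and "0 \<le> \<alpha>"
    and dis: "\<And>a b a' b'. (a, b) \<in> R \<Longrightarrow> (a', b') \<in> R \<Longrightarrow>
      \<bar>mdist X a a' - mdist Y b b'\<bar> \<le> 2 * \<alpha>"
    and x: "x \<in> mspace X"
  shows "\<exists>z\<in>mspace X. \<exists>y\<in>mspace Y. \<forall>(a, b)\<in>R.
    mdist X z a \<le> mdist X x a + \<alpha> \<and> \<bar>mdist X z a - mdist Y y b\<bar> \<le> 2 * \<alpha>"
proof -
  define D where "D r s = (mdist X (fst r) (fst s) + mdist Y (snd r) (snd s)) / 2"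
    for r s :: "'a \<times> 'b"
  have fstR: "fst r \<in> mspace X" and sndR: "snd r \<in> mspace Y" if "r \<in> R" for r
    using R that by auto
  have DX: "\<bar>D r s - mdist X (fst r) (fst s)\<bar> \<le> \<alpha>"
    and DY: "\<bar>D r s - mdist Y (snd r) (snd s)\<bar> \<le> \<alpha>" if "r \<in> R" "s \<in> R" for r s
    using dis[of "fst r" "snd r" "fst s" "snd s"] that by (auto simp: D_def field_simps abs_le_iff)
  have D_refl: "D r r = 0" if "r \<in> R" for r
    using mdist_zero[OF fstR fstR, OF that that] mdist_zero[OF sndR sndR, OF that that]
    by (simp add: D_def)
  have D_commute: "D r s = D s r" for r s
    by (simp add: D_def mdist_commute)

  \<comment> \<open>The two summands \<open>\<alpha>/2\<close> pay for the excess of \<open>D\<close> over the metric of \<open>X\<close>.\<close>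
  define E0 where "E0 = (\<lambda>r. (r, mdist X x (fst r) + \<alpha> / 2)) ` R"
  define P where "P p q \<longleftrightarrow> D (fst p) (fst q) \<le> snd p + snd q"
    for p q :: "('a \<times> 'b) \<times> real"
  have "symp P"
    by (intro sympI) (simp add: P_def D_commute add.commute)
  moreover have "E0 \<subseteq> R \<times> UNIV" by (auto simp: E0_def)
  moreover have "\<forall>p\<in>E0. \<forall>q\<in>E0. P p q"
    unfolding E0_def ball_simps
  proof (intro ballI)
    fix r s assume r: "r \<in> R" and s: "s \<in> R"
    have "mdist X (fst r) (fst s) \<le> mdist X (fst r) x + mdist X x (fst s)"
      by (intro mdist_triangle fstR r s x)
    then show "P (r, mdist X x (fst r) + \<alpha> / 2) (s, mdist X x (fst s) + \<alpha> / 2)"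
      using DX[OF r s] by (simp add: P_def mdist_commute[of X "fst r" x] abs_le_iff)
  qed
  ultimately obtain E where E: "E0 \<subseteq> E" "E \<subseteq> R \<times> UNIV" "\<forall>p\<in>E. \<forall>q\<in>E. P p q"
    and max: "\<forall>p\<in>R \<times> UNIV. P p p \<longrightarrow> (\<forall>q\<in>E. P p q) \<longrightarrow> p \<in> E"
    using maximal_clique_exists[of P E0 "R \<times> UNIV"] by (elim meta_impE exE conjE)
  have ER: "s \<in> R" if "(s, u) \<in> E" for s u
    using E(2) that by auto
  have E_le: "D r s \<le> t + u" if "(r, t) \<in> E" "(s, u) \<in> E" for r s t u
    using E(3)[rule_format, OF that] by (simp add: P_def)
  have E_max: "(r, c) \<in> E"
    if "r \<in> R" "0 \<le> c" "\<And>s u. (s, u) \<in> E \<Longrightarrow> D r s \<le> c + u" for r c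
    by (rule max[rule_format]) (use that in \<open>auto simp: P_def D_refl\<close>)

  have "\<exists>z\<in>mspace X. (\<forall>(r, t)\<in>E. mdist X z (fst r) \<le> t + \<alpha> / 2) \<and>
      (\<forall>r\<in>R. (r, mdist X z (fst r) + 3 * \<alpha> / 2) \<in> E)"
    by (rule injective_metric_realizes_minimal_radii[where D = D])
      (fact inj(1) \<open>0 \<le> \<alpha>\<close> fstR DX ER E_le E_max)+
  then obtain z where z: "z \<in> mspace X" "\<forall>(r, t)\<in>E. mdist X z (fst r) \<le> t + \<alpha> / 2"
      "\<forall>r\<in>R. (r, mdist X z (fst r) + 3 * \<alpha> / 2) \<in> E"
    by (elim bexE conjE)
  have "\<exists>y\<in>mspace Y. (\<forall>(r, t)\<in>E. mdist Y y (snd r) \<le> t + \<alpha> / 2) \<and>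
      (\<forall>r\<in>R. (r, mdist Y y (snd r) + 3 * \<alpha> / 2) \<in> E)"
    by (rule injective_metric_realizes_minimal_radii[where D = D])
      (fact inj(2) \<open>0 \<le> \<alpha>\<close> sndR DY ER E_le E_max)+
  then obtain y where y: "y \<in> mspace Y" "\<forall>(r, t)\<in>E. mdist Y y (snd r) \<le> t + \<alpha> / 2"
      "\<forall>r\<in>R. (r, mdist Y y (snd r) + 3 * \<alpha> / 2) \<in> E"
    by (elim bexE conjE)
  have "mdist X z a \<le> mdist X x a + \<alpha> \<and> \<bar>mdist X z a - mdist Y y b\<bar> \<le> 2 * \<alpha>"
    if ab: "(a, b) \<in> R" for a b
  proof
    have "((a, b), mdist X x a + \<alpha> / 2) \<in> E"
      using E(1) ab by (force simp: E0_def)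
    from bspec[OF z(2) this] show "mdist X z a \<le> mdist X x a + \<alpha>" by simp
    \<comment> \<open>The upper estimate for one of the two points applies to the radius that the lower estimate for
      the other one puts into \<open>E\<close>.\<close>
    have "mdist Y y b \<le> mdist X z a + 2 * \<alpha>"
      using bspec[OF y(2) bspec[OF z(3) ab]] by simp
    moreover have "mdist X z a \<le> mdist Y y b + 2 * \<alpha>"
      using bspec[OF z(2) bspec[OF y(3) ab]] by simp
    ultimately show "\<bar>mdist X z a - mdist Y y b\<bar> \<le> 2 * \<alpha>" by linarith
  qed
  then show ?thesis using z(1) y(1) by (intro bexI[of _ z] bexI[of _ y]) auto
qed

theorem proposition2p1:
  fixes X :: "'a metric" and Y :: "'b metric" and R :: "('a \<times> 'b) set" and \<alpha> :: real
  assumes "injective_metric X" and "injective_metric Y"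
    and "R \<subseteq> mspace X \<times> mspace Y"
    and "0 \<le> \<alpha>" and "ennreal \<alpha> = distortion X Y R / 2"
    and "spans X (fst ` R)"
  shows "\<exists>R'. R \<subseteq> R' \<and> R' \<subseteq> mspace X \<times> mspace Y \<and>
              is_net X \<alpha> (fst ` R') \<and> distortion X Y R' = distortion X Y R"
proof -
  define P where "P = (\<lambda>(a, b) (a', b'). \<bar>mdist X a a' - mdist Y b b'\<bar> \<le> 2 * \<alpha>)"
  have "distortion X Y R = 2 * (distortion X Y R / 2)"
    by (simp add: ennreal_times_divide mult_divide_eq_ennreal mult.commute[of 2])
  also have "\<dots> = ennreal (2 * \<alpha>)"
    using assms(4) by (simp flip: assms(5) add: ennreal_mult)
  finally have dis: "distortion X Y R = ennreal (2 * \<alpha>)" .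
  have "symp P"
    by (intro sympI) (simp add: P_def mdist_commute split_beta)
  moreover have "\<forall>p\<in>R. \<forall>q\<in>R. P p q"
    using distortion_le_iff[of "2 * \<alpha>" X Y R] dis assms(4) by (auto simp: P_def)
  ultimately obtain R' where R': "R \<subseteq> R'" "R' \<subseteq> mspace X \<times> mspace Y"
      "\<forall>p\<in>R'. \<forall>q\<in>R'. P p q"
    and max: "\<forall>p\<in>mspace X \<times> mspace Y. P p p \<longrightarrow> (\<forall>q\<in>R'. P p q) \<longrightarrow> p \<in> R'"
    using maximal_clique_exists[of P R "mspace X \<times> mspace Y"] assms(3)
    by (elim meta_impE exE conjE)
  have R'_dis: "\<bar>mdist X a a' - mdist Y b b'\<bar> \<le> 2 * \<alpha>"
    if "(a, b) \<in> R'" "(a', b') \<in> R'" for a b a' b'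
    using R'(3)[rule_format, OF that] by (simp add: P_def)

  have "distortion X Y R' \<le> ennreal (2 * \<alpha>)"
    using R'_dis assms(4) by (subst distortion_le_iff) auto
  moreover have "distortion X Y R \<le> distortion X Y R'"
    unfolding distortion_def using R'(1) by (intro SUP_subset_mono) auto
  ultimately have "distortion X Y R' = distortion X Y R"
    using dis by simp
  moreover have "\<exists>c\<in>fst ` R'. mdist X x c \<le> \<alpha>" if x: "x \<in> mspace X" for x
  proof -
    have "\<exists>z\<in>mspace X. \<exists>y\<in>mspace Y. \<forall>(a, b)\<in>R'.
      mdist X z a \<le> mdist X x a + \<alpha> \<and> \<bar>mdist X z a - mdist Y y b\<bar> \<le> 2 * \<alpha>"
      by (rule compatible_pair_near) (fact assms(1,2,4) R'(2) R'_dis x)+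
    then obtain z y where z: "z \<in> mspace X" and y: "y \<in> mspace Y"
      and near: "\<forall>(a, b)\<in>R'. mdist X z a \<le> mdist X x a + \<alpha> \<and>
        \<bar>mdist X z a - mdist Y y b\<bar> \<le> 2 * \<alpha>"
      by (elim bexE)
    have self: "mdist X z z = 0" "mdist Y y y = 0"
      using z y by simp_all
    have "(z, y) \<in> R'"
      by (rule max[rule_format])
        (use z y assms(4) near in \<open>auto simp: P_def self\<close>)
    moreover have "mdist X z x \<le> \<alpha>"
      by (rule spans_mdist_le[OF assms(6) x z]) (use near R'(1) in fastforce)
    ultimately show ?thesis
      by (metis fst_conv image_eqI mdist_commute)
  qed
  then have "is_net X \<alpha> (fst ` R')"
    using R'(2) assms(4) by (auto simp: is_net_def)
  ultimately show ?thesis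
    using R'(1,2) by blast
qed

end
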